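(* Let $M\in\mathrm{O}_{n_3}(\mathbb{R})$. A symmetric tensor $\mathcal{A}\in\mathbb{R}_M^{n\times n}$ is $\star_M$-PSD if and only if for each $J\subseteq\{1,\dots,n\}$, the $\star_M$-principal minor $\det_M(\mathcal{A}_{J,J})$ is a square in $\mathbb{R}_M$.
   Context: $\mathrm{O}_{n_3}(\mathbb{R})$ is the group of real orthogonal $n_3\times n_3$ matrices. A tube is an element $\mathbf{a}\in\mathbb{R}^{1\times1\times n_3}$; $\mathrm{vec}(\mathbf{a})\in\mathbb{R}^{n_3}$ has entries $\mathbf{a}_{1,1,k}$, and $\mathrm{tube}$ is the inverse of $\mathrm{vec}$; $\mathrm{diag}(v)$ is the diagonal matrix with diagonal $v$. The $\star_M$-product of tubes is $\mathbf{a}\star_M\mathbf{b}=\mathrm{tube}(M^{-1}\mathrm{diag}(M\mathrm{vec}(\mathbf{a}))M\mathrm{vec}(\mathbf{b}))$, and $\mathbb{R}_M$ is the resulting commutative ring of tubes; a square in $\mathbb{R}_M$ is an element of the form $\mathbf{x}\star_M\mathbf{x}$ with $\mathbf{x}\in\mathbb{R}_M$. $\mathbb{R}_M^{n_1\times n_2}$ denotes $\mathbb{R}^{n_1\times n_2\times n_3}$ viewed as $n_1\times n_2$ matrices of tubes $\mathcal{A}_{i,j,:}$, with product $(\mathcal{A}\star_M\mathcal{B})_{i,j,:}=\sum_\ell\mathcal{A}_{i,\ell,:}\star_M\mathcal{B}_{\ell,j,:}$; $\mathbb{R}_M^n=\mathbb{R}^{n\times1\times n_3}$. The inner product is $\langle\mathcal{A},\mathcal{B}\rangle=\sum_{i,j,k}\mathcal{A}_{i,j,k}\mathcal{B}_{i,j,k}$.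 A tensor is symmetric if every frontal slice $\mathcal{A}_{:,:,k}$ is a symmetric matrix. A symmetric $\mathcal{A}\in\mathbb{R}_M^{n\times n}$ is $\star_M$-PSD if $\langle\mathcal{X},\mathcal{A}\star_M\mathcal{X}\rangle\ge0$ for all $\mathcal{X}\in\mathbb{R}_M^n$. For $J=\{j_1<j_2<\cdots<j_\ell\}\subseteq\{1,\dots,n\}$, the $\star_M$-principal minor indexed by $J$ is the tube $$\det\nolimits_M(\mathcal{A}_{J,J})=\sum_{\sigma\in S_\ell}\mathrm{sgn}(\sigma)\,\mathcal{A}_{j_1,j_{\sigma(1)},:}\star_M\mathcal{A}_{j_2,j_{\sigma(2)},:}\star_M\cdots\star_M\mathcal{A}_{j_\ell,j_{\sigma(\ell)},:}\in\mathbb{R}_M,$$ where $S_\ell$ is the symmetric group (for $J=\emptyset$, the empty product is the multiplicative identity of $\mathbb{R}_M$). *)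

theory Defs
  imports "HOL-Analysis.Analysis" "HOL-Combinatorics.Permutations"
begin

text \<open>
  The type \<open>'k\<close> indexes the third mode (so \<open>n\<^sub>3\<close> is \<open>CARD('k)\<close>) and a tube is identified with
  its vector in \<open>real^'k\<close>, which makes vec and tube identities.  A tensor is a matrix of
  tubes; the entry with index \<open>(i, j, k)\<close> is \<open>A $ i $ j $ k\<close>.
\<close>

type_synonym 'k tube = "real^'k"
type_synonym ('k, 'n, 'm) tensor = "real^'k^'n^'m"

definition diag_mat :: "real^'k \<Rightarrow> real^'k^'k" where
  "diag_mat v = (\<chi> i j. if i = j then v $ i else 0)"

definition tube_mult :: "real^'k^'k \<Rightarrow> 'k::finite tube \<Rightarrow> 'k tube \<Rightarrow> 'k tube" where
  "tube_mult M a b = matrix_inv M *v (diag_mat (M *v a) *v (M *v b))"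

definition tube_one :: "real^'k^'k \<Rightarrow> 'k::finite tube" where
  "tube_one M = matrix_inv M *v (\<chi> i. 1)"

definition tube_square :: "real^'k^'k \<Rightarrow> 'k::finite tube \<Rightarrow> bool" where
  "tube_square M a \<longleftrightarrow> (\<exists>x. a = tube_mult M x x)"

definition tensor_mult ::
  "real^'k^'k \<Rightarrow> ('k::finite, 'l::finite, 'm::finite) tensor \<Rightarrow> ('k, 'p::finite, 'l) tensor
    \<Rightarrow> ('k, 'p, 'm) tensor" where
  "tensor_mult M A B = (\<chi> i j. \<Sum>l\<in>UNIV. tube_mult M (A $ i $ l) (B $ l $ j))"

definition frontal_slice :: "('k::finite, 'n::finite, 'm::finite) tensor \<Rightarrow> 'k \<Rightarrow> real^'n^'m" where
  "frontal_slice A k = (\<chi> i j. A $ i $ j $ k)"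

definition symmetric_tensor :: "('k::finite, 'n::finite, 'n) tensor \<Rightarrow> bool" where
  "symmetric_tensor A \<longleftrightarrow> (\<forall>k. transpose (frontal_slice A k) = frontal_slice A k)"

text \<open>
  The library inner product on \<open>real^'k^1^'n\<close> is the sum of the products of corresponding
  entries (lemma \<open>inner_tensor\<close> below).
\<close>

definition tensor_psd :: "real^'k^'k \<Rightarrow> ('k::finite, 'n::finite, 'n) tensor \<Rightarrow> bool" where
  "tensor_psd M A \<longleftrightarrow>
     symmetric_tensor A \<and> (\<forall>X :: ('k, 1, 'n) tensor. X \<bullet> tensor_mult M A X \<ge> 0)"

text \<open>
  With \<open>js\<close> the increasing enumeration of \<open>J\<close> (0-based), \<open>\<sigma>\<close> permutes the positions
  \<open>{..<card J}\<close>.  For empty \<open>J\<close> the only permutation is \<open>id\<close> and the value is \<open>tube_one M\<close>.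
\<close>

definition principal_minor ::
  "real^'k^'k \<Rightarrow> ('k::finite, 'n::{finite,linorder}, 'n) tensor \<Rightarrow> 'n set \<Rightarrow> 'k tube" where
  "principal_minor M A J =
     (let js = sorted_list_of_set J in
        \<Sum>\<sigma> | \<sigma> permutes {..<card J}.
          of_int (sign \<sigma>) *\<^sub>R
            foldr (tube_mult M) (map (\<lambda>i. A $ (js ! i) $ (js ! \<sigma> i)) [0..<card J]) (tube_one M))"

lemma inner_tensor:
  fixes A B :: "('k::finite, 'n::finite, 'm::finite) tensor"
  shows "A \<bullet> B = (\<Sum>i\<in>UNIV. \<Sum>j\<in>UNIV. \<Sum>k\<in>UNIV. A $ i $ j $ k * B $ i $ j $ k)"
  by (simp add: inner_vec_def)

lemma diag_mat_mult_vec: "diag_mat u *v v = (\<chi> i. u $ i * v $ i)"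
  by (simp add: vec_eq_iff diag_mat_def matrix_vector_mult_def if_distrib [of "\<lambda>x. x * _"]
      cong: if_cong)

lemma tube_mult_one:
  fixes M :: "real^'k^'k"
  assumes "invertible M"
  shows "tube_mult M (tube_one M) a = a" and "tube_mult M a (tube_one M) = a"
proof -
  have "M ** matrix_inv M = mat 1 \<and> matrix_inv M ** M = mat 1"
    using assms unfolding invertible_def matrix_inv_def by (rule someI_ex)
  then have "M *v (matrix_inv M *v v) = v" "matrix_inv M *v (M *v v) = v" for v
    by (simp_all add: matrix_vector_mul_assoc)
  then show "tube_mult M (tube_one M) a = a" "tube_mult M a (tube_one M) = a"
    by (simp_all add: tube_mult_def tube_one_def diag_mat_mult_vec)
qed

lemma principal_minor_empty: "principal_minor M A {} = tube_one M"
  by (simp add: principal_minor_def)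

end

theory Submission imports Defs begin

text \<open>
  Applying \<open>M\<close> to every tube turns the tensor product into the product of the
  transformed frontal slices, so both sides decouple over the slices: \<open>A\<close> is PSD iff every
  transformed slice is a PSD matrix, the transform of a minor lists the ordinary minors of the
  slices, and a tube is a square iff its transform is nonnegative.  It remains to show that a real
  symmetric matrix \<open>B\<close> is PSD iff its principal minors are nonnegative.  If \<open>B\<close> is PSD, the
  determinant of a principal submatrix cannot vanish on the segment to the identity before reaching
  \<open>B\<close>, so it does not change sign.  Conversely \<open>det (B + t I)\<close> is a polynomial in \<open>t\<close> with the
  principal minors as coefficients, hence positive for \<open>t > 0\<close>, which excludes a negative
  eigenvalue.
\<close>

section \<open>Principal minors of real matrices\<close>

text \<open>The Leibniz sum runs over permutations of \<open>J\<close> itself, which avoids a matrix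
  type indexed by \<open>J\<close> and any enumeration of its elements.\<close>

definition matrix_minor :: "real^'n^'n \<Rightarrow> 'n set \<Rightarrow> real" where
  "matrix_minor B J = (\<Sum>\<sigma> | \<sigma> permutes J. of_int (sign \<sigma>) * (\<Prod>i\<in>J. B $ i $ \<sigma> i))"

text \<open>A permutation that moves a point outside \<open>J\<close> meets a zero entry in that
  row. The surviving ones permute \<open>J\<close>, and each row outside \<open>J\<close>
  contributes a factor \<open>t\<close>. With \<open>t = 1\<close> a minor becomes a determinant of
  full size.\<close>

lemma det_replace_rows_axis:
  fixes B :: "real^'n^'n"
  shows "det (\<chi> i j. if i \<in> J then B $ i $ j else if i = j then t else 0)
    = t ^ card (- J) * matrix_minor B J"
proof -
  let ?c = "\<lambda>\<sigma> i. if i \<in> J then B $ i $ \<sigma> i else if i = \<sigma> i then t else 0"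
  have "det (\<chi> i j. if i \<in> J then B $ i $ j else if i = j then t else 0)
      = (\<Sum>\<sigma> | \<sigma> permutes UNIV. of_int (sign \<sigma>) * (\<Prod>i\<in>UNIV. ?c \<sigma> i))"
    by (simp add: det_def)
  also have "\<dots> = (\<Sum>\<sigma> | \<sigma> permutes J. of_int (sign \<sigma>) * (\<Prod>i\<in>UNIV. ?c \<sigma> i))"
  proof (rule sum.mono_neutral_right)
    show "{\<sigma>. \<sigma> permutes J} \<subseteq> {\<sigma>. \<sigma> permutes UNIV}"
      using permutes_subset by blast
    show "\<forall>\<sigma>\<in>{\<sigma>. \<sigma> permutes UNIV} - {\<sigma>. \<sigma> permutes J}.
        of_int (sign \<sigma>) * (\<Prod>i\<in>UNIV. ?c \<sigma> i) = 0"
    proof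
      fix \<sigma> :: "'n \<Rightarrow> 'n"
      assume "\<sigma> \<in> {\<sigma>. \<sigma> permutes UNIV} - {\<sigma>. \<sigma> permutes J}"
      then obtain i where "i \<notin> J" "\<sigma> i \<noteq> i"
        using permutes_superset [of \<sigma> UNIV J] by auto
      then have "?c \<sigma> i = 0"
        by auto
      then have "(\<Prod>i\<in>UNIV. ?c \<sigma> i) = 0"
        using prod_zero [OF finite [of UNIV], of "?c \<sigma>"] UNIV_I by metis
      then show "of_int (sign \<sigma>) * (\<Prod>i\<in>UNIV. ?c \<sigma> i) = 0"
        by simp
    qed
  qed (simp add: finite_permutations)
  also have "\<dots> = (\<Sum>\<sigma> | \<sigma> permutes J. of_int (sign \<sigma>) * (t ^ card (- J) * (\<Prod>i\<in>J. B $ i $ \<sigma> i)))"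
  proof (rule sum.cong)
    fix \<sigma>
    assume "\<sigma> \<in> {\<sigma>. \<sigma> permutes J}"
    then have "(\<Prod>i\<in>- J. ?c \<sigma> i) = (\<Prod>i\<in>- J. t)"
      by (intro prod.cong) (auto simp: permutes_not_in)
    moreover have "(\<Prod>i\<in>UNIV. ?c \<sigma> i) = (\<Prod>i\<in>- J. ?c \<sigma> i) * (\<Prod>i\<in>J. ?c \<sigma> i)"
      using prod.subset_diff [of J UNIV "?c \<sigma>"] by (simp add: Compl_eq_Diff_UNIV)
    ultimately show "of_int (sign \<sigma>) * (\<Prod>i\<in>UNIV. ?c \<sigma> i)
        = of_int (sign \<sigma>) * (t ^ card (- J) * (\<Prod>i\<in>J. B $ i $ \<sigma> i))"
      by simp
  qed simp
  finally show ?thesis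
    by (simp add: matrix_minor_def sum_distrib_left mult_ac)
qed

lemma matrix_minor_empty [simp]: "matrix_minor B {} = 1"
  by (simp add: matrix_minor_def)

text \<open>Multiplying out the sums \<open>B $ i $ \<sigma> i + ?d \<sigma> i\<close> chooses the
  set \<open>J\<close> of rows taken from \<open>B\<close>; the other rows come from
  \<open>mat t\<close>.\<close>

lemma det_add_mat:
  fixes B :: "real^'n^'n"
  shows "det (B + mat t) = (\<Sum>J\<in>UNIV. t ^ card (- J) * matrix_minor B J)"
proof -
  let ?d = "\<lambda>\<sigma> i. if i = \<sigma> i then t else 0"
  let ?c = "\<lambda>J \<sigma> i. if i \<in> J then B $ i $ \<sigma> i else ?d \<sigma> i"
  have split: "(\<Prod>i\<in>UNIV. B $ i $ \<sigma> i + ?d \<sigma> i) = (\<Sum>J\<in>UNIV. \<Prod>i\<in>UNIV. ?c J \<sigma> i)" for \<sigma>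
  proof -
    have "(\<Prod>i\<in>J. B $ i $ \<sigma> i) * (\<Prod>i\<in>UNIV - J. ?d \<sigma> i) = (\<Prod>i\<in>UNIV. ?c J \<sigma> i)" for J
      using prod.subset_diff [of J UNIV "?c J \<sigma>"] by simp
    then show ?thesis
      by (subst prod_add) simp_all
  qed
  have "det (B + mat t)
      = (\<Sum>\<sigma> | \<sigma> permutes UNIV. of_int (sign \<sigma>) * (\<Prod>i\<in>UNIV. B $ i $ \<sigma> i + ?d \<sigma> i))"
    by (simp add: det_def mat_def)
  also have "\<dots> = (\<Sum>J\<in>UNIV. \<Sum>\<sigma> | \<sigma> permutes UNIV. of_int (sign \<sigma>) * (\<Prod>i\<in>UNIV. ?c J \<sigma> i))"
    unfolding split sum_distrib_left by (rule sum.swap)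
  also have "\<dots> = (\<Sum>J\<in>UNIV. t ^ card (- J) * matrix_minor B J)"
    by (simp add: det_replace_rows_axis [symmetric] det_def)
  finally show ?thesis .
qed

section \<open>Semidefiniteness and the signs of the principal minors\<close>

lemma det_eq_0_iff_kernel:
  fixes B :: "real^'n^'n"
  shows "det B = 0 \<longleftrightarrow> (\<exists>x. x \<noteq> 0 \<and> B *v x = 0)"
  using invertible_det_nz [of B] by (auto simp: invertible_left_inverse matrix_left_invertible_ker)

text \<open>A zero of the determinant on the segment would give a nonzero \<open>x\<close> supported
  on \<open>J\<close> at which the quadratic form vanishes, although it is at least
  \<open>s * (x \<bullet> x) > 0\<close>.\<close>

lemma matrix_minor_nonneg_of_psd:
  fixes B :: "real^'n^'n"
  assumes psd: "\<And>x. 0 \<le> x \<bullet> (B *v x)"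
  shows "0 \<le> matrix_minor B J"
proof (rule ccontr)
  \<comment> \<open>The rows outside \<open>J\<close> are unit rows, so \<open>det (C s)\<close> is
    the minor for \<open>J\<close> of the point at parameter \<open>s\<close> on the segment from
    \<open>B\<close> to the identity.\<close>
  define C where "C s = (\<chi> i j. if i \<in> J then ((1 - s) *\<^sub>R B + mat s) $ i $ j
    else if i = j then 1 else 0)" for s :: real
  assume "\<not> 0 \<le> matrix_minor B J"
  then have neg: "det (C 0) < 0"
    by (simp add: C_def mat_0 det_replace_rows_axis)
  have "C 1 = mat 1"
    by (simp add: C_def vec_eq_iff mat_def)
  then have pos: "det (C 1) = 1"
    by simp
  have entry: "isCont (\<lambda>s. C s $ i $ j) s" for i j s
    by (cases "i \<in> J"; cases "i = j") (simp_all add: C_def mat_def)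
  have "\<exists>s\<ge>0. s \<le> 1 \<and> det (C s) = 0"
    by (rule IVT) (use neg pos in \<open>auto simp: det_def intro!: continuous_intros entry\<close>)
  then obtain s where s: "0 \<le> s" "s \<le> 1" "det (C s) = 0"
    by blast
  then have "s > 0"
    using neg by (cases "s = 0") auto
  obtain x where "x \<noteq> 0" and ker: "C s *v x = 0"
    using s(3) by (auto simp: det_eq_0_iff_kernel)
  have out: "x $ i = 0" if "i \<notin> J" for i
  proof -
    have "(C s *v x) $ i = (\<Sum>j\<in>UNIV. (if i = j then 1 else 0) * x $ j)"
      using that by (simp add: C_def matrix_vector_mult_def)
    then show ?thesis
      by (simp add: ker if_distrib [of "\<lambda>a. a * _"] cong: if_cong)
  qed
  \<comment> \<open>The full segment matrix need not annihilate \<open>x\<close>: its rows agree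
    with those of \<open>C s\<close> only on \<open>J\<close>. Off \<open>J\<close> the factor
    \<open>x $ i\<close> vanishes instead.\<close>
  have "x $ i * (((1 - s) *\<^sub>R B + mat s) *v x) $ i = 0" for i
  proof (cases "i \<in> J")
    case True
    then have "(((1 - s) *\<^sub>R B + mat s) *v x) $ i = (C s *v x) $ i"
      by (simp add: C_def matrix_vector_mult_def)
    then show ?thesis
      by (simp add: ker)
  qed (simp add: out)
  then have "0 = x \<bullet> (((1 - s) *\<^sub>R B + mat s) *v x)"
    unfolding inner_vec_def inner_real_def by (intro sum.neutral [symmetric]) blast
  also have "mat s *v x = s *\<^sub>R x"
    by (simp add: vec_eq_iff matrix_vector_mult_def mat_def if_distrib [of "\<lambda>a. a * _"] cong: if_cong)
  then have "x \<bullet> (((1 - s) *\<^sub>R B + mat s) *v x) = (1 - s) * (x \<bullet> (B *v x)) + s * (x \<bullet> x)"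
    by (simp add: matrix_vector_mult_add_rdistrib inner_right_distrib
        scaleR_matrix_vector_assoc [symmetric])
  also have "\<dots> > 0"
    using s psd [of x] \<open>s > 0\<close> \<open>x \<noteq> 0\<close> by (simp add: add_nonneg_pos)
  finally show False
    by simp
qed

text \<open>The form attains its minimum 0 at \<open>x\<close>, so its gradient
  \<open>2 * B x\<close> must vanish there; otherwise a small step against \<open>B *v x\<close>
  would make the form negative.\<close>

lemma symmetric_psd_kernel:
  fixes B :: "real^'n^'n"
  assumes sym: "transpose B = B"
    and psd: "\<And>x. 0 \<le> x \<bullet> (B *v x)"
    and "x \<bullet> (B *v x) = 0"
  shows "B *v x = 0"
proof (rule ccontr)
  define y where "y = B *v x"
  assume "B *v x \<noteq> 0"
  then have y: "y \<bullet> y > 0"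
    by (simp add: y_def)
  define q where "q = y \<bullet> (B *v y)"
  \<comment> \<open>The summand 1 keeps the denominator positive when \<open>q = 0\<close>. This
    choice turns the form at \<open>x + s *\<^sub>R y\<close> into
    \<open>s * (y \<bullet> y) - s * s\<close>, which is negative.\<close>
  define s where "s = - (y \<bullet> y) / (q + 1)"
  have "q \<ge> 0"
    by (simp add: q_def psd)
  have "x \<bullet> (B *v y) = y \<bullet> y"
    using dot_lmul_matrix [of x B y] sym
    by (simp add: y_def flip: transpose_matrix_vector)
  then have "(x + s *\<^sub>R y) \<bullet> (B *v (x + s *\<^sub>R y)) = 2 * s * (y \<bullet> y) + s * s * q"
    using assms(3)
    by (simp add: matrix_vector_right_distrib matrix_vector_mult_scaleR inner_left_distrib
        inner_right_distrib q_def algebra_simps flip: y_def)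
  moreover have "s * (q + 1) = - (y \<bullet> y)"
    using \<open>q \<ge> 0\<close> by (simp add: s_def)
  then have "s * q = - (y \<bullet> y) - s"
    by (simp add: algebra_simps)
  then have "2 * s * (y \<bullet> y) + s * s * q = s * (y \<bullet> y) - s * s"
    by (simp add: mult.assoc) (simp add: algebra_simps)
  moreover have "s * (y \<bullet> y) < 0"
    using \<open>q \<ge> 0\<close> y by (intro mult_neg_pos) (simp_all add: s_def divide_neg_pos)
  moreover have "0 \<le> s * s"
    by simp
  ultimately show False
    using psd [of "x + s *\<^sub>R y"] by linarith
qed

text \<open>The minimum \<open>l\<close> of the form on the unit sphere is an eigenvalue, so
  \<open>det (B - l I) = 0\<close>. The expansion of this determinant in principal minors rules out
  \<open>l < 0\<close>.\<close>

lemma psd_of_matrix_minor_nonneg: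
  fixes B :: "real^'n^'n"
  assumes sym: "transpose B = B"
    and minors: "\<And>J. 0 \<le> matrix_minor B J"
  shows "0 \<le> x \<bullet> (B *v x)"
proof -
  have "continuous_on (sphere 0 1) (\<lambda>x. x \<bullet> (B *v x))"
    by (intro continuous_intros)
  moreover have "sphere 0 1 \<noteq> ({} :: (real^'n) set)"
    by (simp add: sphere_eq_empty)
  ultimately obtain u where u: "norm u = 1"
    and umin: "\<And>v. norm v = 1 \<Longrightarrow> u \<bullet> (B *v u) \<le> v \<bullet> (B *v v)"
    using continuous_attains_inf [OF compact_sphere, of 0 1 "\<lambda>x. x \<bullet> (B *v x)"] by auto
  define l where "l = u \<bullet> (B *v u)"
  have lower: "l * (v \<bullet> v) \<le> v \<bullet> (B *v v)" for v
  proof (cases "v = 0")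
    case False
    define w where "w = v /\<^sub>R norm v"
    have v: "norm v *\<^sub>R w = v" and "norm w = 1"
      using False by (simp_all add: w_def)
    have "(norm v *\<^sub>R w) \<bullet> (B *v (norm v *\<^sub>R w)) = (norm v)\<^sup>2 * (w \<bullet> (B *v w))"
      by (simp add: matrix_vector_mult_scaleR power2_eq_square)
    then have "v \<bullet> (B *v v) = (norm v)\<^sup>2 * (w \<bullet> (B *v w))"
      by (simp only: v)
    moreover have "l \<le> w \<bullet> (B *v w)"
      unfolding l_def using \<open>norm w = 1\<close> by (rule umin)
    ultimately show ?thesis
      by (simp add: dot_square_norm mult.commute [of l] mult_left_mono)
  qed simp
  have shift: "(B + mat (- l)) *v v = B *v v - l *\<^sub>R v" for v
    by (simp add: vec_eq_iff matrix_vector_mult_def mat_def distrib_right sum.distrib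
        if_distrib [of "\<lambda>a. a * _"] cong: if_cong)
  \<comment> \<open>By \<open>lower\<close>, the shifted matrix is PSD, and its form vanishes at the
    minimizer \<open>u\<close>; hence \<open>u\<close> is an eigenvector for
    \<open>l\<close>.\<close>
  have "(B + mat (- l)) *v u = 0"
  proof (rule symmetric_psd_kernel)
    show "transpose (B + mat (- l)) = B + mat (- l)"
      using sym by (auto simp: vec_eq_iff transpose_def mat_def)
    show "0 \<le> v \<bullet> ((B + mat (- l)) *v v)" for v
      using lower [of v] by (simp add: shift inner_diff_right)
    show "u \<bullet> ((B + mat (- l)) *v u) = 0"
      unfolding shift using u by (simp add: inner_diff_right dot_square_norm flip: l_def)
  qed
  moreover have "u \<noteq> 0"
    using u by auto
  ultimately have "det (B + mat (- l)) = 0"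
    unfolding det_eq_0_iff_kernel by blast
  moreover have "det (B + mat (- l)) > 0" if "l < 0"
  proof -
    \<comment> \<open>The empty set contributes the leading term \<open>(- l) ^ n\<close>, with
      \<open>n\<close> the size of the matrix; all other terms are nonnegative.\<close>
    have "0 < (- l) ^ card (- {} :: 'n set) * matrix_minor B {}"
      using that by simp
    also have "\<dots> \<le> (\<Sum>J\<in>UNIV. (- l) ^ card (- J) * matrix_minor B J)"
      using that minors by (intro member_le_sum) auto
    finally show ?thesis
      by (simp add: det_add_mat)
  qed
  ultimately have "0 \<le> l"
    by force
  then have "0 \<le> l * (x \<bullet> x)"
    by simp
  then show ?thesis
    using lower order_trans by blast
qed

theorem psd_iff_matrix_minors_nonneg:
  fixes B :: "real^'n^'n"
  assumes "transpose B = B"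
  shows "(\<forall>x. 0 \<le> x \<bullet> (B *v x)) \<longleftrightarrow> (\<forall>J. 0 \<le> matrix_minor B J)"
  using matrix_minor_nonneg_of_psd psd_of_matrix_minor_nonneg [OF assms] by blast

section \<open>The transformed slices\<close>

definition transformed_slice ::
  "real^'k^'k \<Rightarrow> ('k::finite, 'n::finite, 'n) tensor \<Rightarrow> 'k \<Rightarrow> real^'n^'n" where
  "transformed_slice M A k = (\<chi> i j. (M *v (A $ i $ j)) $ k)"

lemma orthogonal_matrix_inv_cancel:
  fixes M :: "real^'k^'k"
  assumes "orthogonal_matrix M"
  shows "M *v (matrix_inv M *v v) = v" "matrix_inv M *v (M *v v) = v"
proof -
  have "invertible M"
    using assms by (auto simp: invertible_def orthogonal_matrix_def)
  then have "M ** matrix_inv M = mat 1 \<and> matrix_inv M ** M = mat 1"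
    unfolding invertible_def matrix_inv_def by (rule someI_ex)
  then show "M *v (matrix_inv M *v v) = v" "matrix_inv M *v (M *v v) = v"
    by (simp_all add: matrix_vector_mul_assoc)
qed

lemma orthogonal_matrix_inner:
  fixes M :: "real^'k^'k"
  assumes "orthogonal_matrix M"
  shows "(M *v v) \<bullet> (M *v w) = v \<bullet> w"
proof -
  have "(M *v v) \<bullet> (M *v w) = ((M *v v) v* M) \<bullet> w"
    by (simp add: dot_lmul_matrix)
  also have "(M *v v) v* M = (transpose M ** M) *v v"
    by (simp add: matrix_vector_mul_assoc flip: transpose_matrix_vector)
  finally show ?thesis
    using assms by (simp add: orthogonal_matrix)
qed

section \<open>Tubes and minors in transformed coordinates\<close>

lemma transform_tube_mult:
  fixes M :: "real^'k^'k"
  assumes "orthogonal_matrix M"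
  shows "(M *v tube_mult M a b) $ k = (M *v a) $ k * (M *v b) $ k"
  by (simp add: tube_mult_def orthogonal_matrix_inv_cancel [OF assms] diag_mat_mult_vec)

lemma transform_foldr_tube_mult:
  fixes M :: "real^'k^'k"
  assumes "orthogonal_matrix M"
  shows "(M *v foldr (tube_mult M) as (tube_one M)) $ k = (\<Prod>a\<leftarrow>as. (M *v a) $ k)"
  by (induction as)
    (simp_all add: transform_tube_mult [OF assms] tube_one_def orthogonal_matrix_inv_cancel [OF assms])

text \<open>In transformed coordinates squaring is entrywise, so a root is obtained by taking real
  square roots there and transforming back.\<close>

lemma tube_square_iff_transform_nonneg:
  fixes M :: "real^'k^'k"
  assumes "orthogonal_matrix M"
  shows "tube_square M a \<longleftrightarrow> (\<forall>k. 0 \<le> (M *v a) $ k)"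
proof
  assume "tube_square M a"
  then show "\<forall>k. 0 \<le> (M *v a) $ k"
    by (auto simp: tube_square_def transform_tube_mult [OF assms])
next
  assume nonneg: "\<forall>k. 0 \<le> (M *v a) $ k"
  define x where "x = matrix_inv M *v (\<chi> k. sqrt ((M *v a) $ k))"
  have "M *v tube_mult M x x = M *v a"
    using nonneg
    by (simp add: vec_eq_iff transform_tube_mult [OF assms] x_def
        orthogonal_matrix_inv_cancel [OF assms])
  then have "tube_mult M x x = a"
    by (metis orthogonal_matrix_inv_cancel(2) [OF assms])
  then show "tube_square M a"
    by (auto simp: tube_square_def)
qed

text \<open>The transform carries the Leibniz sum over tubes to one over reals in each coordinate.
  Conjugation by the enumeration \<open>js\<close> then turns permutations of positions into
  permutations of \<open>J\<close> and preserves signs.\<close>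

lemma transform_principal_minor:
  fixes M :: "real^'k^'k" and A :: "('k::finite, 'n::{finite,linorder}, 'n) tensor"
  assumes "orthogonal_matrix M"
  shows "(M *v principal_minor M A J) $ k = matrix_minor (transformed_slice M A k) J"
proof -
  define js where "js = sorted_list_of_set J"
  define I where "I = {..<card J}"
  let ?B = "transformed_slice M A k"
  have bij: "bij_betw ((!) js) I J"
    by (rule bij_betw_nth) (simp_all add: js_def I_def)
  then have inj: "inj_on ((!) js) I"
    by (rule bij_betw_imp_inj_on)
  have bij_map: "bij_betw (map_permutation I ((!) js)) {\<sigma>. \<sigma> permutes I} {\<sigma>. \<sigma> permutes J}"
  proof -
    have "map_permutation I ((!) js) \<sigma> = (\<lambda>x. if x \<in> J then js ! \<sigma> (inv_into I ((!) js) x) else x)" for \<sigma>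
      using bij by (auto simp: map_permutation_def restrict_id_def bij_betw_def fun_eq_iff)
    then show ?thesis
      using bij_betw_permutations [OF bij] by presburger
  qed
  have "(M *v principal_minor M A J) $ k
      = (\<Sum>\<sigma> | \<sigma> permutes I. of_int (sign \<sigma>) *
          (M *v foldr (tube_mult M) (map (\<lambda>i. A $ (js ! i) $ (js ! \<sigma> i)) [0..<card J]) (tube_one M)) $ k)"
    by (simp add: principal_minor_def Let_def js_def I_def linear_sum [OF matrix_vector_mul_linear]
        matrix_vector_mult_scaleR)
  also have "\<dots> = (\<Sum>\<sigma> | \<sigma> permutes I. of_int (sign \<sigma>) * (\<Prod>i\<in>I. ?B $ (js ! i) $ (js ! \<sigma> i)))"
    by (simp add: transform_foldr_tube_mult [OF assms] transformed_slice_def o_def I_def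
        lessThan_atLeast0 flip: prod.distinct_set_conv_list)
  also have "\<dots> = (\<Sum>\<sigma> | \<sigma> permutes I. of_int (sign (map_permutation I ((!) js) \<sigma>)) *
      (\<Prod>i\<in>J. ?B $ i $ map_permutation I ((!) js) \<sigma> i))"
  proof (rule sum.cong)
    fix \<sigma>
    assume "\<sigma> \<in> {\<sigma>. \<sigma> permutes I}"
    then have "sign (map_permutation I ((!) js) \<sigma>) = sign \<sigma>"
      using inj by (simp add: sign_map_permutation I_def)
    moreover have "(\<Prod>i\<in>I. ?B $ (js ! i) $ (js ! \<sigma> i))
        = (\<Prod>i\<in>I. ?B $ (js ! i) $ map_permutation I ((!) js) \<sigma> (js ! i))"
      using inj by (simp add: map_permutation_apply)
    moreover have "\<dots> = (\<Prod>i\<in>J. ?B $ i $ map_permutation I ((!) js) \<sigma> i)"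
      by (rule prod.reindex_bij_betw [OF bij])
    ultimately show "of_int (sign \<sigma>) * (\<Prod>i\<in>I. ?B $ (js ! i) $ (js ! \<sigma> i))
        = of_int (sign (map_permutation I ((!) js) \<sigma>)) *
          (\<Prod>i\<in>J. ?B $ i $ map_permutation I ((!) js) \<sigma> i)"
      by simp
  qed simp
  also have "\<dots> = matrix_minor ?B J"
    unfolding matrix_minor_def by (rule sum.reindex_bij_betw [OF bij_map])
  finally show ?thesis .
qed

section \<open>Decoupling the quadratic form over the slices\<close>

lemma symmetric_tensor_entry:
  assumes "symmetric_tensor A"
  shows "A $ i $ j = A $ j $ i"
proof -
  have "transpose (frontal_slice A k) $ j $ i = frontal_slice A k $ j $ i" for k
    using assms by (simp add: symmetric_tensor_def)
  then show ?thesis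
    by (simp add: transpose_def frontal_slice_def vec_eq_iff)
qed

text \<open>Orthogonality of \<open>M\<close> lets the inner product be computed after the
  transform, where tube products are entrywise. Exchanging the sums over rows and coordinates leaves
  one matrix form per slice.\<close>

lemma inner_tensor_mult:
  fixes M :: "real^'k^'k" and A :: "('k::finite, 'n::finite, 'n) tensor"
    and X :: "('k, 1, 'n) tensor"
  assumes "orthogonal_matrix M"
  defines "x \<equiv> \<lambda>k. \<chi> i. (M *v (X $ i $ 1)) $ k"
  shows "X \<bullet> tensor_mult M A X = (\<Sum>k\<in>UNIV. x k \<bullet> (transformed_slice M A k *v x k))"
proof -
  have "X \<bullet> tensor_mult M A X
      = (\<Sum>i\<in>UNIV. (M *v (X $ i $ 1)) \<bullet> (M *v (\<Sum>l\<in>UNIV. tube_mult M (A $ i $ l) (X $ l $ 1))))"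
    by (simp add: inner_vec_def [of X] inner_vec_def [of "X $ _"] tensor_mult_def
        orthogonal_matrix_inner [OF assms(1)] sum_1)
  also have "\<dots> = (\<Sum>i\<in>UNIV. \<Sum>k\<in>UNIV. (x k $ i) * (transformed_slice M A k *v x k) $ i)"
    by (simp add: inner_vec_def linear_sum [OF matrix_vector_mul_linear]
        transform_tube_mult [OF assms(1)] x_def
        matrix_vector_mult_def [of "transformed_slice M A _"])
      (simp add: transformed_slice_def)
  also have "\<dots> = (\<Sum>k\<in>UNIV. x k \<bullet> (transformed_slice M A k *v x k))"
    by (subst sum.swap) (simp add: inner_vec_def)
  finally show ?thesis .
qed

lemma tensor_psd_iff_slices_psd:
  fixes M :: "real^'k^'k" and A :: "('k::finite, 'n::finite, 'n) tensor"
  assumes M: "orthogonal_matrix M" and A: "symmetric_tensor A"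
  shows "tensor_psd M A \<longleftrightarrow> (\<forall>k x. 0 \<le> x \<bullet> (transformed_slice M A k *v x))"
proof
  assume "\<forall>k x. 0 \<le> x \<bullet> (transformed_slice M A k *v x)"
  then show "tensor_psd M A"
    using A by (auto simp: tensor_psd_def inner_tensor_mult [OF M] intro!: sum_nonneg)
next
  assume psd: "tensor_psd M A"
  show "\<forall>k x. 0 \<le> x \<bullet> (transformed_slice M A k *v x)"
  proof (intro allI)
    fix k and x :: "real^'n"
    \<comment> \<open>The transform of \<open>X\<close> is \<open>x\<close> in slice
      \<open>k\<close> and zero in all others, which isolates a single term of the sum.\<close>
    define X :: "('k, 1, 'n) tensor" where "X = (\<chi> i j. matrix_inv M *v axis k (x $ i))"
    have "(\<chi> i. (M *v (X $ i $ 1)) $ m) = (if m = k then x else 0)" for m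
      by (simp add: X_def orthogonal_matrix_inv_cancel [OF M] axis_def vec_eq_iff)
    then have "X \<bullet> tensor_mult M A X
        = (\<Sum>m\<in>UNIV. if m = k then x \<bullet> (transformed_slice M A k *v x) else 0)"
      unfolding inner_tensor_mult [OF M] by (intro sum.cong) auto
    moreover have "0 \<le> X \<bullet> tensor_mult M A X"
      using psd by (simp add: tensor_psd_def)
    ultimately show "0 \<le> x \<bullet> (transformed_slice M A k *v x)"
      by simp
  qed
qed

theorem proposition3p6:
  fixes M :: "real^'k^'k"
    and A :: "('k::finite, 'n::{finite,linorder}, 'n) tensor"
  assumes "orthogonal_matrix M"
    and "symmetric_tensor A"
  shows "tensor_psd M A \<longleftrightarrow> (\<forall>J :: 'n set. tube_square M (principal_minor M A J))"
proof -
  \<comment> \<open>The transform mixes the original slices, but symmetry survives because the tubes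
    at \<open>(i, j)\<close> and \<open>(j, i)\<close> are equal.\<close>
  have "transpose (transformed_slice M A k) = transformed_slice M A k" for k
    unfolding transpose_def transformed_slice_def
    by (simp add: symmetric_tensor_entry [OF assms(2)] vec_eq_iff)
  then have "tensor_psd M A \<longleftrightarrow> (\<forall>k J. 0 \<le> matrix_minor (transformed_slice M A k) J)"
    by (simp add: tensor_psd_iff_slices_psd [OF assms] psd_iff_matrix_minors_nonneg)
  then show ?thesis
    by (auto simp: tube_square_iff_transform_nonneg [OF assms(1)]
        transform_principal_minor [OF assms(1)])
qed

end
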